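(* Let $P,Q,R$ be arbitrary integers and let $(G_n)_{n\ge 0}$ be the Generalized Tribonacci sequence defined by $G_{n+3}=PG_{n+2}+QG_{n+1}+RG_n$ with $G_0=0$, $G_1=0$, $G_2=1$. Let $n\ge 1$, $w=e^{2\pi i/n}$, and let $C_n(G)=\mathrm{circ}(G_1,G_2,\ldots,G_n)$ be the $n\times n$ circulant matrix whose first row is $(G_1,G_2,\ldots,G_n)$ and each subsequent row is the cyclic right shift of the preceding one. Then for $j=0,1,\ldots,n-1$ the eigenvalues of $C_n(G)$ are \[ \lambda_j(C_n(G))=\frac{G_{n+1}+\left(G_{n+2}-PG_{n+1}-1\right)w^{-j}+RG_n w^{-2j}}{Pw^{-j}+Qw^{-2j}+Rw^{-3j}-1}, \] for every $j$ for which the denominator $Pw^{-j}+Qw^{-2j}+Rw^{-3j}-1$ is nonzero.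
   Context: For $a_0,\dots,a_{n-1}\in\mathbb{C}$, $\mathrm{circ}(a_0,\ldots,a_{n-1})$ denotes the $n\times n$ matrix $[c_{ij}]$ with $c_{ij}=a_{j-i}$ if $j\ge i$ and $c_{ij}=a_{n+j-i}$ if $j<i$; its $j$-th eigenvalue is indexed as $\lambda_j=\sum_{k=0}^{n-1}a_k w^{-jk}$. *)

theory Defs
  imports Complex_Main "Jordan_Normal_Form.Char_Poly"
begin

fun gen_trib :: "int \<Rightarrow> int \<Rightarrow> int \<Rightarrow> nat \<Rightarrow> int" where
  "gen_trib P Q R 0 = 0"
| "gen_trib P Q R (Suc 0) = 0"
| "gen_trib P Q R (Suc (Suc 0)) = 1"
| "gen_trib P Q R (Suc (Suc (Suc n))) =
     P * gen_trib P Q R (Suc (Suc n)) + Q * gen_trib P Q R (Suc n) + R * gen_trib P Q R n"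

definition circ :: "complex list \<Rightarrow> complex mat" where
  "circ a = (let n = length a in
     mat n n (\<lambda>(i, j). if i \<le> j then a ! (j - i) else a ! (n + j - i)))"

text \<open>The enumeration of the eigenvalues of \<open>circ a\<close>: the \<open>j\<close>-th one belongs to the
  eigenvector \<open>(1, x, x\<^sup>2, \<dots>)\<close> with \<open>x = w\<^bsup>-j\<^esup>\<close>, where \<open>w = e\<^bsup>2\<pi>i/n\<^esup>\<close> and \<open>n = length a\<close>.\<close>

definition circ_eigenvalue :: "complex list \<Rightarrow> nat \<Rightarrow> complex" where
  "circ_eigenvalue a j = (let n = length a; w = exp (2 * of_real pi * \<i> / of_nat n) in
     (\<Sum>k<n. a ! k * w powi (- (int j * int k))))"

end

theory Submission
  imports Defs
begin

text \<open>The discrete Fourier matrix diagonalizes every circulant matrix: the row sums of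
  \<open>circ a\<close> against the powers of an \<open>n\<close>-th root of unity \<open>x\<close> are the same up to the factor
  \<open>x\<^sup>i\<close>, and the Fourier matrix is invertible by orthogonality of the characters. The closed form of
  the eigenvalues holds because the partial sums of the generating function of \<open>G\<close>, multiplied by
  \<open>P x + Q x\<^sup>2 + R x\<^sup>3 - 1\<close>, telescope.\<close>

text \<open>No condition on \<open>x\<close> is needed for the telescoping: the terms carrying
  \<open>x ^ n\<close> and higher are the upper boundary, and the lone \<open>- x\<close> is the
  lower one, coming from \<open>G 2 = 1\<close>.\<close>

lemma gen_trib_partial_sum:
  fixes x :: "'a::comm_ring_1" and P Q R :: int
  defines "G \<equiv> (\<lambda>k. of_int (gen_trib P Q R k) :: 'a)"
  shows "(of_int P * x + of_int Q * x ^ 2 + of_int R * x ^ 3 - 1) * (\<Sum>k<n. G (Suc k) * x ^ k)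
    = G (n + 1) * x ^ n + (G (n + 2) - of_int P * G (n + 1)) * x ^ (n + 1)
      + of_int R * G n * x ^ (n + 2) - x"
proof (induction n)
  case 0
  show ?case by (simp add: G_def numeral_2_eq_2)
next
  case (Suc n)
  \<comment> \<open>In the increment of the right-hand side, \<open>x ^ (n + 2)\<close> has
    coefficient G(n+3) - P G(n+2) - R G(n), which the recurrence turns into Q G(n+1).\<close>
  have rec: "G (Suc n + 2) = of_int P * G (n + 2) + of_int Q * G (n + 1) + of_int R * G n"
    by (simp add: G_def)
  show ?case
    unfolding sum.lessThan_Suc distrib_left Suc.IH rec
    by (simp add: algebra_simps power2_eq_square power3_eq_cube)
qed

text \<open>Exponents of \<open>x\<close> matter only modulo the length of \<open>a\<close>, so the
  cyclic shift of a row merely permutes the summands.\<close>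

lemma circ_row_sum:
  assumes x: "x ^ length a = 1" and i: "i < length a"
  shows "(\<Sum>m<length a. circ a $$ (i, m) * x ^ m) = x ^ i * (\<Sum>k<length a. a ! k * x ^ k)"
proof -
  define n where "n = length a"
  have "x ^ i * (\<Sum>k<n. a ! k * x ^ k) = (\<Sum>k<n. a ! k * x ^ (k + i))"
    by (simp add: sum_distrib_left power_add mult_ac)
  also have "\<dots> = (\<Sum>m<n. circ a $$ (i, m) * x ^ m)"
  \<comment> \<open>The witnesses are subtraction and addition of \<open>i\<close> modulo
    \<open>n\<close>, split into cases to match the two branches of \<open>circ\<close>.\<close>
  proof (rule sum.reindex_bij_witness[of _ "\<lambda>m. if i \<le> m then m - i else n + m - i"
        "\<lambda>k. if k + i < n then k + i else k + i - n"])
    fix k assume k: "k \<in> {..<n}"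
    show "circ a $$ (i, if k + i < n then k + i else k + i - n)
        * x ^ (if k + i < n then k + i else k + i - n) = a ! k * x ^ (k + i)"
    proof (cases "k + i < n")
      case True
      then show ?thesis using i k by (simp add: circ_def n_def Let_def)
    next
      case False
      then have "x ^ (k + i) = x ^ (k + i - n) * x ^ n" by (simp flip: power_add)
      then show ?thesis using False i k x by (auto simp: circ_def n_def Let_def)
    qed
  qed (use i in \<open>auto simp: n_def\<close>)
  finally show ?thesis by (simp add: n_def)
qed

lemma primitive_root_power_inj:
  assumes w: "w = exp (2 * of_real pi * \<i> / of_nat n)" and "i < n" "j < n" "w ^ i = w ^ j"
  shows "i = j"
proof -
  have pow: "w ^ k = cis (2 * pi * real k / real n)" for k
    by (simp add: w cis_conv_exp flip: exp_of_nat_mult) (simp add: field_simps)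
  have "inj_on (\<lambda>k. cis (2 * pi * real k / real n)) {..<n}"
    using bij_betw_roots_unity[of n] assms(2) by (auto simp: bij_betw_def)
  then show ?thesis using assms(2-4) unfolding pow by (auto dest: inj_onD)
qed

text \<open>The sum is geometric with ratio \<open>y\<close>, an \<open>n\<close>-th root of unity.
  For \<open>i = k\<close> every term is 1; otherwise \<open>y \<noteq> 1\<close> because the powers
  of \<open>w\<close> below \<open>n\<close> are distinct, and \<open>y ^ n = 1\<close> makes the
  sum vanish.\<close>

lemma roots_of_unity_orthogonal:
  assumes w: "w = exp (2 * of_real pi * \<i> / of_nat n)" and "i < n" "k < n"
  shows "(\<Sum>j<n. inverse w ^ (i * j) * w ^ (j * k)) = (if i = k then of_nat n else 0)"
proof -
  have w0: "w \<noteq> 0" by (simp add: w)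
  have wn: "w ^ n = 1" using assms(2) by (simp add: w flip: exp_of_nat_mult)
  define y where "y = inverse w ^ i * w ^ k"
  have "y ^ n = inverse (w ^ n) ^ i * (w ^ n) ^ k"
    by (simp add: y_def power_mult_distrib power_inverse mult.commute flip: power_mult)
  then have yn: "y ^ n = 1" by (simp add: wn)
  have "(\<Sum>j<n. inverse w ^ (i * j) * w ^ (j * k)) = (\<Sum>j<n. y ^ j)"
    by (simp add: y_def power_mult_distrib mult.commute flip: power_mult)
  also have "\<dots> = (if i = k then of_nat n else 0)"
  proof (cases "i = k")
    case True
    then have "y = 1" using w0 by (simp add: y_def flip: power_mult_distrib)
    then show ?thesis using True by simp
  next
    case False
    then have "w ^ i \<noteq> w ^ k" using primitive_root_power_inj[OF w] assms by blast
    then have "y \<noteq> 1" using w0 by (auto simp: y_def field_simps)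
    then show ?thesis using False yn by (simp add: geometric_sum)
  qed
  finally show ?thesis .
qed

text \<open>Natural powers of the inverse root replace negative exponents, giving the form in which
  \<open>circ_row_sum\<close> applies.\<close>

lemma circ_eigenvalue_altdef:
  "circ_eigenvalue a j = (\<Sum>k<length a. a ! k *
     (inverse (exp (2 * of_real pi * \<i> / of_nat (length a))) ^ j) ^ k)"
  by (simp add: circ_eigenvalue_def Let_def power_int_minus power_inverse
      flip: power_mult of_nat_mult)

lemma circ_similar_diagonal:
  assumes n: "n = length a" and pos: "n > 0"
  shows "similar_mat (circ a) (mat n n (\<lambda>(i, j). if i = j then circ_eigenvalue a j else 0))"
proof -
  define w where "w = exp (2 * of_real pi * \<i> / of_nat n)"
  define C where "C = circ a"
  define D where "D = mat n n (\<lambda>(i, j). if i = j then circ_eigenvalue a j else 0)"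
  define F where "F = mat n n (\<lambda>(i, j). inverse w ^ (i * j))"
  \<comment> \<open>The conjugate Fourier matrix, scaled by the value \<open>n\<close> of the
    diagonal character sums.\<close>
  define F' where "F' = mat n n (\<lambda>(i, j). w ^ (i * j) / of_nat n)"
  have C: "C \<in> carrier_mat n n" by (simp add: C_def circ_def Let_def n)
  have D: "D \<in> carrier_mat n n" and F: "F \<in> carrier_mat n n" and F': "F' \<in> carrier_mat n n"
    by (simp_all add: D_def F_def F'_def)
  have FF': "F * F' = 1\<^sub>m n"
  proof (rule eq_matI)
    fix i k assume "i < dim_row (1\<^sub>m n :: complex mat)" "k < dim_col (1\<^sub>m n :: complex mat)"
    then have ik: "i < n" "k < n" by simp_all
    have "(F * F') $$ (i, k) = (\<Sum>j<n. inverse w ^ (i * j) * w ^ (j * k)) / of_nat n"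
      using ik by (simp add: F_def F'_def scalar_prod_def lessThan_atLeast0 sum_divide_distrib)
    then show "(F * F') $$ (i, k) = 1\<^sub>m n $$ (i, k)"
      using ik pos by (simp add: roots_of_unity_orthogonal[OF w_def])
  qed (simp_all add: F_def F'_def)
  have F'F: "F' * F = 1\<^sub>m n"
    by (rule mat_mult_left_right_inverse[OF F F' FF'])
  \<comment> \<open>Column \<open>j\<close> of \<open>F\<close> is the eigenvector of powers of
    \<open>inverse w ^ j\<close>.\<close>
  have "C * F = F * D"
  proof (rule eq_matI)
    fix i j assume "i < dim_row (F * D)" "j < dim_col (F * D)"
    then have ij: "i < n" "j < n" by (simp_all add: F_def D_def)
    have "w ^ n = 1" using pos by (simp add: w_def flip: exp_of_nat_mult)
    then have "(inverse w ^ j) ^ n = 1"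
      by (metis inverse_1 mult.commute power_inverse power_mult power_one)
    then have row: "(\<Sum>m<n. C $$ (i, m) * (inverse w ^ j) ^ m)
        = (inverse w ^ j) ^ i * circ_eigenvalue a j"
      using circ_row_sum[of "inverse w ^ j" a i] ij
      by (simp add: C_def circ_eigenvalue_altdef w_def n)
    have "(C * F) $$ (i, j) = (\<Sum>m<n. C $$ (i, m) * (inverse w ^ j) ^ m)"
      using ij C by (simp add: F_def scalar_prod_def lessThan_atLeast0 mult.commute flip: power_mult)
    moreover have "(F * D) $$ (i, j) = (inverse w ^ j) ^ i * circ_eigenvalue a j"
      using ij by (simp add: F_def D_def scalar_prod_def if_distrib[of "(*) _"] mult.commute
          flip: power_mult cong: if_cong)
    ultimately show "(C * F) $$ (i, j) = (F * D) $$ (i, j)" using row by simp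
  qed (use C in \<open>simp_all add: F_def D_def\<close>)
  then have "F * D * F' = C"
    using assoc_mult_mat[OF C F F'] FF' C by simp
  then have "similar_mat_wit C D F F'"
    using C D F F' FF' F'F by (intro similar_mat_witI[of _ _ n]) auto
  then show ?thesis unfolding similar_mat_def C_def D_def by blast
qed

text \<open>Passing through the characteristic polynomial records the eigenvalues with multiplicity,
  so the enumeration is complete.\<close>

lemma char_poly_circ:
  assumes "length a > 0"
  shows "char_poly (circ a) = (\<Prod>j<length a. [:- circ_eigenvalue a j, 1:])"
proof -
  let ?n = "length a"
  let ?D = "mat ?n ?n (\<lambda>(i, j). if i = j then circ_eigenvalue a j else 0)"
  have "char_poly (circ a) = char_poly ?D"
    by (rule char_poly_similar[OF circ_similar_diagonal[OF refl assms]])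
  also have "\<dots> = (\<Prod>c\<leftarrow>diag_mat ?D. [:- c, 1:])"
    by (rule char_poly_upper_triangular[of _ ?n]) (auto simp: upper_triangular_def)
  also have "diag_mat ?D = map (circ_eigenvalue a) [0..<?n]"
    by (simp add: diag_mat_def)
  finally show ?thesis
    by (simp add: o_def prod.distinct_set_conv_list lessThan_atLeast0 flip: set_upt)
qed

theorem theorem4:
  fixes P Q R :: int and n :: nat and w :: complex
    and G :: "nat \<Rightarrow> complex" and C :: "complex mat" and lam :: "nat \<Rightarrow> complex"
  assumes n: "n \<ge> 1"
    and w: "w = exp (2 * of_real pi * \<i> / of_nat n)"
    and G: "G = (\<lambda>k. of_int (gen_trib P Q R k))"
    and C: "C = circ (map G [1..<n + 1])"
    and lam: "lam = circ_eigenvalue (map G [1..<n + 1])"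
  shows "char_poly C = (\<Prod>j<n. [:- lam j, 1:]) \<and>
    (\<forall>j<n. eigenvalue C (lam j) \<and>
      (of_int P * w powi (- int j) + of_int Q * w powi (- 2 * int j)
          + of_int R * w powi (- 3 * int j) - 1 \<noteq> 0 \<longrightarrow>
       lam j = (G (n + 1) + (G (n + 2) - of_int P * G (n + 1) - 1) * w powi (- int j)
                 + of_int R * G n * w powi (- 2 * int j))
             / (of_int P * w powi (- int j) + of_int Q * w powi (- 2 * int j)
                 + of_int R * w powi (- 3 * int j) - 1)))"
proof (intro conjI allI impI)
  let ?a = "map G [1..<n + 1]"
  have len: "length ?a = n" by simp
  have carrier: "C \<in> carrier_mat n n" unfolding C circ_def Let_def len by simp
  show char_poly: "char_poly C = (\<Prod>j<n. [:- lam j, 1:])"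
    using char_poly_circ[of ?a] n unfolding C lam len by simp
  fix j assume j: "j < n"
  have "poly (char_poly C) (lam j) = 0"
    using j by (auto simp: char_poly poly_prod)
  then show "eigenvalue C (lam j)"
    using eigenvalue_root_char_poly[OF carrier] by simp
  define x where "x = inverse w ^ j"
  have "w ^ n = 1" using n by (simp add: w flip: exp_of_nat_mult)
  then have xn: "x ^ n = 1"
    by (metis inverse_1 mult.commute power_inverse power_mult power_one x_def)
  have powi: "w powi (- int j) = x" "w powi (- 2 * int j) = x ^ 2" "w powi (- 3 * int j) = x ^ 3"
  proof -
    have *: "w powi (- int (j * k)) = x ^ k" for k
      by (simp only: power_int_minus power_int_of_nat x_def power_mult power_inverse)
    show "w powi (- int j) = x" "w powi (- 2 * int j) = x ^ 2" "w powi (- 3 * int j) = x ^ 3"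
      using *[of 1] *[of 2] *[of 3] by (simp_all add: mult.commute)
  qed
  \<comment> \<open>The first row starts at \<open>G 1\<close>, hence the shift to
    \<open>Suc k\<close>.\<close>
  have lam_j: "lam j = (\<Sum>k<n. G (Suc k) * x ^ k)"
    unfolding lam circ_eigenvalue_altdef len x_def w
    by (intro sum.cong) (simp_all del: upt_Suc)
  assume nz: "of_int P * w powi (- int j) + of_int Q * w powi (- 2 * int j)
      + of_int R * w powi (- 3 * int j) - 1 \<noteq> 0"
  \<comment> \<open>With \<open>x ^ n = 1\<close> the boundary powers become 1, \<open>x\<close> and
    \<open>x ^ 2\<close>, and the lone \<open>- x\<close> joins the coefficient of
    \<open>x\<close>.\<close>
  have "(of_int P * x + of_int Q * x ^ 2 + of_int R * x ^ 3 - 1) * lam j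
      = G (n + 1) + (G (n + 2) - of_int P * G (n + 1) - 1) * x + of_int R * G n * x ^ 2"
    using gen_trib_partial_sum[of P x Q R n] unfolding lam_j G power_add xn
    by (simp add: algebra_simps)
  then show "lam j = (G (n + 1) + (G (n + 2) - of_int P * G (n + 1) - 1) * w powi (- int j)
        + of_int R * G n * w powi (- 2 * int j))
      / (of_int P * w powi (- int j) + of_int Q * w powi (- 2 * int j)
        + of_int R * w powi (- 3 * int j) - 1)"
    using nz unfolding powi by (metis nonzero_mult_div_cancel_left)
qed

end
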